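(* Let $X$, $Y$ and $Z$ be (finite-dimensional, real) random vectors with finite second moments such that $X$ and $Z$ are adjusted orthogonal given $Y$, i.e. $\mathrm{Cov}_{Y}(X,Z)=0$. Then $$\mathrm{P}_{[X]}^{\{Z\}} = \mathrm{P}_{[Y]}^{\{Z\}}\,\mathrm{P}_{[X]}^{\{Y\}}$$ and $$\mathrm{T}_{[X]}^{\{Z\}} = \mathrm{P}_{[Y]}^{\{Z\}}\,\mathrm{T}_{[X]}^{\{Y\}}\,\mathrm{P}_{[Z]}^{\{Y\}}.$$
   Context: All random vectors are finite-dimensional real column vectors, defined jointly, whose components have finite second moments. For random vectors $B,C$ (possibly of different dimensions), $\mathrm{Cov}(B,C)=\mathrm{E}(BC^{T})-\mathrm{E}(B)\mathrm{E}(C)^{T}$ and $\mathrm{Var}(B)=\mathrm{Cov}(B,B)$. For a matrix $A$, $A^{\dagger}$ denotes its Moore-Penrose generalised inverse (variance matrices are allowed to be singular). For random vectors $B,C,D$ define: - $\mathrm{P}_{[D]}^{\{B\}} = \mathrm{Cov}(B,D)\,\mathrm{Var}(D)^{\dagger}$; - $\mathrm{T}_{[D]}^{\{B\}} = \mathrm{P}_{[D]}^{\{B\}}\,\mathrm{P}_{[B]}^{\{D\}}$; - $\mathrm{E}_{D}(B)=\mathrm{E}(B)+\mathrm{P}_{[D]}^{\{B\}}\,[D-\mathrm{E}(D)]$ (the expectation of $B$ adjusted by $D$); - $\mathrm{Cov}_{D}(B,C)=\mathrm{Cov}\big(B-\mathrm{E}_{D}(B),\,C-\mathrm{E}_{D}(C)\big)$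 (the covariance between $B$ and $C$ adjusted by $D$). $B$ and $C$ are adjusted orthogonal given $D$ if and only if $\mathrm{Cov}_{D}(B,C)=0$. *)

theory Defs
  imports "HOL-Probability.Probability"
begin

definition outer :: "real ^ 'm \<Rightarrow> real ^ 'n \<Rightarrow> real ^ 'n ^ 'm" where
  "outer u v = (\<chi> i j. u $ i * v $ j)"

definition moore_penrose :: "real ^ 'n ^ 'm \<Rightarrow> real ^ 'm ^ 'n \<Rightarrow> bool" where
  "moore_penrose A G \<longleftrightarrow>
     A ** G ** A = A \<and>
     G ** A ** G = G \<and>
     transpose (A ** G) = A ** G \<and>
     transpose (G ** A) = G ** A"

lemma moore_penrose_unique:
  assumes "moore_penrose A G" and "moore_penrose A H"
  shows "G = H"
proof -
  have G: "A ** G ** A = A" "G ** A ** G = G"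
      "transpose (A ** G) = A ** G" "transpose (G ** A) = G ** A"
    and H: "A ** H ** A = A" "H ** A ** H = H"
      "transpose (A ** H) = A ** H" "transpose (H ** A) = H ** A"
    using assms by (auto simp: moore_penrose_def)
  have "A ** G = (A ** H) ** (A ** G)"
    by (metis H(1) matrix_mul_assoc)
  then have "A ** G = transpose ((A ** G) ** (A ** H))"
    by (metis G(3) H(3) matrix_transpose_mul)
  then have 1: "A ** G = A ** H"
    by (metis G(1) H(3) matrix_mul_assoc)
  have "G ** A = (G ** A) ** (H ** A)"
    by (metis H(1) matrix_mul_assoc)
  then have "G ** A = transpose ((H ** A) ** (G ** A))"
    by (metis G(4) H(4) matrix_transpose_mul)
  then have 2: "G ** A = H ** A"
    by (metis G(1) H(4) matrix_mul_assoc)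
  show ?thesis
    by (metis G(2) H(2) 1 2 matrix_mul_assoc)
qed

definition pinv :: "real ^ 'n ^ 'm \<Rightarrow> real ^ 'm ^ 'n" where
  "pinv A = (THE G. moore_penrose A G)"

definition finite_second_moments :: "'w measure \<Rightarrow> ('w \<Rightarrow> real ^ 'n) \<Rightarrow> bool" where
  "finite_second_moments M B \<longleftrightarrow> (\<forall>i. integrable M (\<lambda>w. (B w $ i)\<^sup>2))"

definition cov :: "'w measure \<Rightarrow> ('w \<Rightarrow> real ^ 'm) \<Rightarrow> ('w \<Rightarrow> real ^ 'n) \<Rightarrow> real ^ 'n ^ 'm" where
  "cov M B C = (LINT w|M. outer (B w) (C w)) - outer (LINT w|M. B w) (LINT w|M. C w)"

definition var :: "'w measure \<Rightarrow> ('w \<Rightarrow> real ^ 'n) \<Rightarrow> real ^ 'n ^ 'n" where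
  "var M B = cov M B B"

text \<open>
  In the four definitions below the conditioning vector \<open>D\<close> precedes the adjusted vectors:
  \<open>adj_P M D B\<close> and \<open>adj_T M D B\<close> are $P_{[D]}^{\{B\}}$ and $T_{[D]}^{\{B\}}$,
  \<open>adj_exp M D B\<close> is $E_D(B)$, and \<open>adj_cov M D B C\<close> is $Cov_D(B,C)$.
\<close>

definition adj_P :: "'w measure \<Rightarrow> ('w \<Rightarrow> real ^ 'd) \<Rightarrow> ('w \<Rightarrow> real ^ 'b) \<Rightarrow> real ^ 'd ^ 'b" where
  "adj_P M D B = cov M B D ** pinv (var M D)"

definition adj_T :: "'w measure \<Rightarrow> ('w \<Rightarrow> real ^ 'd) \<Rightarrow> ('w \<Rightarrow> real ^ 'b) \<Rightarrow> real ^ 'b ^ 'b" where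
  "adj_T M D B = adj_P M D B ** adj_P M B D"

definition adj_exp :: "'w measure \<Rightarrow> ('w \<Rightarrow> real ^ 'd) \<Rightarrow> ('w \<Rightarrow> real ^ 'b) \<Rightarrow> 'w \<Rightarrow> real ^ 'b" where
  "adj_exp M D B w = (LINT v|M. B v) + adj_P M D B *v (D w - (LINT v|M. D v))"

definition adj_cov ::
  "'w measure \<Rightarrow> ('w \<Rightarrow> real ^ 'd) \<Rightarrow> ('w \<Rightarrow> real ^ 'b) \<Rightarrow> ('w \<Rightarrow> real ^ 'c) \<Rightarrow> real ^ 'c ^ 'b" where
  "adj_cov M D B C = cov M (\<lambda>w. B w - adj_exp M D B w) (\<lambda>w. C w - adj_exp M D C w)"

definition adjusted_orthogonal ::
  "'w measure \<Rightarrow> ('w \<Rightarrow> real ^ 'd) \<Rightarrow> ('w \<Rightarrow> real ^ 'b) \<Rightarrow> ('w \<Rightarrow> real ^ 'c) \<Rightarrow> bool" where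
  "adjusted_orthogonal M D B C \<longleftrightarrow> adj_cov M D B C = 0"

end

theory Submission
  imports Defs
begin

text \<open>
  Since \<open>G = Var(Y)\<^sup>\<dagger>\<close> is symmetric and \<open>G Var(Y) G = G\<close>, bilinearity of the covariance collapses
  the adjusted covariance to \<open>Cov\<^sub>Y(X, Z) = Cov(X, Z) - Cov(X, Y) G Cov(Y, Z)\<close>. Adjusted orthogonality
  thus factors \<open>Cov(X, Z)\<close> through \<open>Y\<close>; multiplying the transposed factorisation by
  \<open>Var(X)\<^sup>\<dagger>\<close> gives the first identity. The hypothesis is symmetric in \<open>X\<close> and \<open>Z\<close>, and the
  product of the two resulting identities is the second one.
\<close>

section \<open>Existence and transposition of the Moore-Penrose inverse\<close>

lemma exists_generalized_inverse:
  fixes A :: "real ^ 'n ^ 'm"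
  obtains W :: "real ^ 'm ^ 'n" where "A ** W ** A = A"
proof -
  \<comment> \<open>\<open>g\<close> chooses, linearly, a preimage for each vector in the range of
    \<open>A\<close>; its matrix is the required \<open>W\<close>.\<close>
  obtain g where g: "linear g" "\<And>v. A *v (g (A *v v)) = A *v v"
    using linear_exists_right_inverse_on[OF matrix_vector_mul_linear subspace_UNIV, of A]
    by auto
  have "A ** matrix g ** A = A"
    unfolding matrix_eq by (simp add: matrix_vector_mul_assoc[symmetric] matrix_works g)
  then show thesis ..
qed

text \<open>A Gram matrix has the same kernel as its factor: if A^T A y = 0, then |A y|^2 = y . (A^T
  A y) = 0. This is applied to y = B x - C x for every x.\<close>

lemma gram_cancel_left:
  fixes A :: "real ^ 'n ^ 'm"
  assumes "transpose A ** A ** B = transpose A ** A ** C"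
  shows "A ** B = A ** C"
  unfolding matrix_eq
proof
  fix x
  define y where "y = B *v x - C *v x"
  have "transpose A *v (A *v y) = 0"
    using arg_cong[OF assms, of "\<lambda>m. m *v x"]
    by (simp add: y_def matrix_vector_mul_assoc[symmetric] matrix_vector_mult_diff_distrib)
  then have "(A *v y) \<bullet> (A *v y) = 0"
    by (metis dot_lmul_matrix inner_zero_left transpose_matrix_vector vector_transpose_matrix inner_commute)
  then show "(A ** B) *v x = (A ** C) *v x"
    by (simp add: y_def matrix_vector_mul_assoc[symmetric] matrix_vector_mult_diff_distrib)
qed

lemma gram_cancel_right:
  fixes A :: "real ^ 'n ^ 'm"
  assumes "B ** A ** transpose A = C ** A ** transpose A"
  shows "B ** A = C ** A"
proof -
  have "transpose (B ** A ** transpose A) = transpose (C ** A ** transpose A)"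
    using assms by simp
  then have "transpose A ** transpose B = transpose A ** transpose C"
    using gram_cancel_left[of "transpose A" "transpose B" "transpose C"]
    by (simp add: matrix_transpose_mul matrix_mul_assoc)
  then show ?thesis
    by (metis matrix_transpose_mul transpose_transpose)
qed

lemma exists_moore_penrose:
  fixes A :: "real ^ 'n ^ 'm"
  shows "\<exists>G. moore_penrose A G"
proof -
  let ?T = "transpose A"
  obtain W where W: "(?T ** A ** ?T) ** W ** (?T ** A ** ?T) = ?T ** A ** ?T"
    by (rule exists_generalized_inverse)
  \<comment> \<open>Zlobec's formula. With an arbitrary \<open>W\<close> only \<open>G A G = G\<close> can fail; \<open>G A G\<close> repairs it.\<close>
  define G where "G = ?T ** W ** ?T"
  \<comment> \<open>This is the defining equation of \<open>W\<close> rebracketed, so that one Gram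
    factor can be cancelled on the left and then another on the right.\<close>
  have "?T ** A ** (G ** A ** ?T) = ?T ** A ** ?T"
    using W by (simp add: G_def matrix_mul_assoc)
  then have "A ** (G ** A ** ?T) = A ** ?T"
    by (rule gram_cancel_left)
  \<comment> \<open>The factor \<open>mat 1\<close> gives the right-hand side the shape that
    \<open>gram_cancel_right\<close> expects.\<close>
  then have "A ** G ** A ** ?T = mat 1 ** A ** ?T"
    by (simp add: matrix_mul_assoc)
  then have AGA: "A ** G ** A = A"
    using gram_cancel_right by fastforce
  have T: "?T ** transpose (A ** G) = ?T" "transpose (G ** A) ** ?T = ?T"
    using AGA by (metis matrix_transpose_mul matrix_mul_assoc)+
  \<comment> \<open>\<open>G\<close> ends with the factor \<open>?T\<close>, which absorbs
    \<open>transpose (A ** G)\<close>. Hence P = \<open>A ** G\<close> satisfies P P^T = P and is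
    symmetric. For \<open>G ** A\<close> the leading factor \<open>?T\<close> of \<open>G\<close> is
    used in the same way.\<close>
  have "(A ** G) ** transpose (A ** G) = A ** G"
    using T(1) unfolding G_def by (metis matrix_mul_assoc)
  then have AG: "transpose (A ** G) = A ** G"
    by (metis matrix_transpose_mul transpose_transpose)
  have "transpose (G ** A) ** (G ** A) = G ** A"
    using T(2) unfolding G_def by (metis matrix_mul_assoc)
  then have GA: "transpose (G ** A) = G ** A"
    by (metis matrix_transpose_mul transpose_transpose)
  have 1: "A ** (G ** A ** G) = A ** G" "G ** A ** G ** A = G ** A"
    using AGA by (metis matrix_mul_assoc)+
  have "moore_penrose A (G ** A ** G)"
    unfolding moore_penrose_def 1 using AGA AG GA 1 by (simp add: matrix_mul_assoc)
  then show ?thesis ..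
qed

text \<open>Existence and uniqueness make the definite description in \<open>pinv\<close> well
  defined, so the Penrose equations are available for every real matrix, including singular
  variances.\<close>

lemma moore_penrose_pinv: "moore_penrose A (pinv A)"
proof -
  obtain G where "moore_penrose A G"
    using exists_moore_penrose by blast
  then show ?thesis
    unfolding pinv_def by (rule theI) (rule moore_penrose_unique[OF _ \<open>moore_penrose A G\<close>])
qed

lemma moore_penrose_transpose:
  assumes "moore_penrose A G"
  shows "moore_penrose (transpose A) (transpose G)"
  using assms unfolding moore_penrose_def matrix_transpose_mul[symmetric] matrix_mul_assoc[symmetric]
  by simp

text \<open>For a symmetric matrix, such as a variance, this says that the pseudoinverse is
  symmetric.\<close>

lemma transpose_pinv: "transpose (pinv A) = pinv (transpose A)"
  by (rule moore_penrose_unique[OF moore_penrose_transpose[OF moore_penrose_pinv] moore_penrose_pinv])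

section \<open>Outer products, linear maps and integrals\<close>

lemma outer_nth: "outer u v $ i $ j = u $ i * v $ j"
  by (simp add: outer_def)

lemma transpose_outer: "transpose (outer u v) = outer v u"
  by (simp add: vec_eq_iff transpose_def outer_nth mult.commute)

lemma outer_diff_left: "outer (u - u') v = outer u v - outer u' v"
  by (simp add: vec_eq_iff outer_nth algebra_simps)

lemma outer_matrix_left: "outer (A *v u) v = A ** outer u v"
  by (simp add: vec_eq_iff outer_nth matrix_vector_mult_def matrix_matrix_mult_def
      sum_distrib_right mult.assoc)

lemma linear_outer_right: "linear (outer u)"
  by (rule linearI) (simp_all add: vec_eq_iff outer_nth algebra_simps)

lemma linear_transpose: "linear (transpose :: real ^ 'n ^ 'm \<Rightarrow> real ^ 'm ^ 'n)"
  by (rule linearI) (simp_all add: vec_eq_iff transpose_def)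

lemma linear_matrix_mul_left: "linear ((**) A :: real ^ 'k ^ 'n \<Rightarrow> real ^ 'k ^ 'm)"
  by (rule linearI)
    (simp_all add: vec_eq_iff matrix_matrix_mult_def algebra_simps sum.distrib sum_distrib_left)

text \<open>In finite dimension every linear map is bounded and so commutes with the Bochner
  integral. Transposition, left multiplication and \<open>outer u\<close> are moved through
  expectations this way.\<close>

lemma integral_linear_euclidean:
  fixes f :: "'a :: euclidean_space \<Rightarrow> 'b :: euclidean_space"
  assumes "linear f" "integrable M g"
  shows "integrable M (\<lambda>w. f (g w))" "(LINT w|M. f (g w)) = f (LINT w|M. g w)"
  using assms
  by (simp_all add: linear_conv_bounded_linear integral_bounded_linear integrable_bounded_linear)

text \<open>The entries are general Euclidean vectors, so two applications reduce a matrix-valued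
  function first to rows and then to real entries.\<close>

lemma integrable_vecI:
  fixes f :: "'w \<Rightarrow> 'a :: euclidean_space ^ 'n"
  assumes "\<And>i. integrable M (\<lambda>w. f w $ i)"
  shows "integrable M f"
proof -
  have lin: "linear (axis i :: 'a \<Rightarrow> 'a ^ 'n)" for i
    by (rule linearI) (simp_all add: vec_eq_iff axis_def)
  have "f = (\<lambda>w. \<Sum>i\<in>UNIV. axis i (f w $ i))"
    by (simp add: fun_eq_iff vec_eq_iff axis_def if_distrib cong: if_cong)
  moreover have "integrable M (\<lambda>w. \<Sum>i\<in>UNIV. axis i (f w $ i))"
    by (intro Bochner_Integration.integrable_sum integral_linear_euclidean(1)[OF lin] assms)
  ultimately show ?thesis by simp
qed

section \<open>Square-integrable random vectors\<close>

lemma borel_measurable_bounded_linear: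
  assumes "bounded_linear f" "g \<in> borel_measurable M"
  shows "(\<lambda>w. f (g w)) \<in> borel_measurable M"
  using assms(2) borel_measurable_continuous_onI[OF linear_continuous_on[OF assms(1)]]
  by (rule measurable_compose)

text \<open>Integrability of the squared components does not control their signs, so measurability
  of the vector itself is bundled in.\<close>

definition square_integrable_vec :: "'w measure \<Rightarrow> ('w \<Rightarrow> real ^ 'n) \<Rightarrow> bool" where
  "square_integrable_vec M B \<longleftrightarrow> B \<in> borel_measurable M \<and> finite_second_moments M B"

text \<open>Each entry is a product of components, dominated by the sum of their squares.\<close>

lemma integrable_outer:
  assumes "square_integrable_vec M B" "square_integrable_vec M C"
  shows "integrable M (\<lambda>w. outer (B w) (C w))"
proof (intro integrable_vecI)
  fix i j
  have "B \<in> borel_measurable M" "C \<in> borel_measurable M"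
    and sq: "integrable M (\<lambda>w. (B w $ i)\<^sup>2)" "integrable M (\<lambda>w. (C w $ j)\<^sup>2)"
    using assms by (auto simp: square_integrable_vec_def finite_second_moments_def)
  have "integrable M (\<lambda>w. B w $ i * C w $ j)"
  proof (rule Bochner_Integration.integrable_bound)
    show "integrable M (\<lambda>w. (B w $ i)\<^sup>2 + (C w $ j)\<^sup>2)"
      using sq by simp
    have "\<bar>a * b\<bar> \<le> a\<^sup>2 + b\<^sup>2" for a b :: real
    proof -
      have "0 \<le> (\<bar>a\<bar> - \<bar>b\<bar>)\<^sup>2" by simp
      then have "2 * \<bar>a * b\<bar> \<le> a\<^sup>2 + b\<^sup>2"
        by (simp add: power2_diff abs_mult)
      then show ?thesis by linarith
    qed
    then show "AE w in M. norm (B w $ i * C w $ j) \<le> norm ((B w $ i)\<^sup>2 + (C w $ j)\<^sup>2)"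
      by (simp add: order_trans[OF _ abs_ge_self])
    show "(\<lambda>w. B w $ i * C w $ j) \<in> borel_measurable M"
      by (intro borel_measurable_times borel_measurable_bounded_linear[OF bounded_linear_vec_nth]) fact+
  qed
  then show "integrable M (\<lambda>w. outer (B w) (C w) $ i $ j)"
    by (simp add: outer_nth)
qed

text \<open>The squared components are the diagonal of \<open>outer (B w) (B w)\<close>. In this
  form, closure under differences and matrix multiplication follows by expanding one outer
  product.\<close>

lemma square_integrable_vec_altdef:
  "square_integrable_vec M B \<longleftrightarrow>
    B \<in> borel_measurable M \<and> integrable M (\<lambda>w. outer (B w) (B w))"
proof (intro iffI conjI)
  assume "square_integrable_vec M B"
  then show "B \<in> borel_measurable M" "integrable M (\<lambda>w. outer (B w) (B w))"
    by (simp_all add: integrable_outer) (simp add: square_integrable_vec_def)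
next
  assume *: "B \<in> borel_measurable M \<and> integrable M (\<lambda>w. outer (B w) (B w))"
  have "integrable M (\<lambda>w. outer (B w) (B w) $ i $ i)" for i
    using * by (intro integrable_bounded_linear[OF bounded_linear_vec_nth]) auto
  with * show "square_integrable_vec M B"
    by (simp add: square_integrable_vec_def finite_second_moments_def outer_nth power2_eq_square)
qed

lemma square_integrable_vec_diff:
  assumes "square_integrable_vec M B" "square_integrable_vec M C"
  shows "square_integrable_vec M (\<lambda>w. B w - C w)"
proof -
  have "outer (B w - C w) (B w - C w) =
      outer (B w) (B w) - outer (B w) (C w) - (outer (C w) (B w) - outer (C w) (C w))" for w
    by (simp add: outer_diff_left linear_diff[OF linear_outer_right])
  moreover have "integrable M (\<lambda>w. outer (B w) (B w) - outer (B w) (C w)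
      - (outer (C w) (B w) - outer (C w) (C w)))"
    by (intro Bochner_Integration.integrable_diff integrable_outer assms)
  ultimately show ?thesis
    using assms by (simp add: square_integrable_vec_altdef borel_measurable_diff)
qed

lemma square_integrable_vec_matrix:
  assumes "square_integrable_vec M B"
  shows "square_integrable_vec M (\<lambda>w. A *v B w)"
proof -
  \<comment> \<open>Transposing in the middle expresses the two-sided product A (B B^T) A^T through
    left multiplications alone.\<close>
  have "outer (A *v B w) (A *v B w) = A ** transpose (A ** outer (B w) (B w))" for w
    by (metis outer_matrix_left transpose_outer)
  moreover have "integrable M (\<lambda>w. A ** transpose (A ** outer (B w) (B w)))"
    by (rule integral_linear_euclidean(1)[OF linear_matrix_mul_left
          integral_linear_euclidean(1)[OF linear_transpose
            integral_linear_euclidean(1)[OF linear_matrix_mul_left integrable_outer[OF assms assms]]]])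
  moreover have "(\<lambda>w. A *v B w) \<in> borel_measurable M"
    using assms borel_measurable_bounded_linear[OF matrix_vector_mul_bounded_linear]
    unfolding square_integrable_vec_def by blast
  ultimately show ?thesis
    by (simp add: square_integrable_vec_altdef)
qed

section \<open>Covariance as a bilinear form\<close>

lemma transpose_cov:
  assumes "square_integrable_vec M B" "square_integrable_vec M C"
  shows "transpose (cov M B C) = cov M C B"
  using integral_linear_euclidean(2)[OF linear_transpose integrable_outer[OF assms]]
  by (simp add: cov_def linear_diff[OF linear_transpose] transpose_outer)

context prob_space
begin

lemma square_integrable_vec_const: "square_integrable_vec M (\<lambda>w. c)"
  by (simp add: square_integrable_vec_altdef)

lemma square_integrable_vec_imp_integrable:
  assumes "square_integrable_vec M B"
  shows "integrable M B"
proof (rule integrable_vecI)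
  fix i
  have "(\<lambda>w. B w $ i) \<in> borel_measurable M"
    using assms borel_measurable_bounded_linear[OF bounded_linear_vec_nth]
    unfolding square_integrable_vec_def by blast
  moreover have "integrable M (\<lambda>w. (B w $ i)\<^sup>2)"
    using assms by (simp add: square_integrable_vec_def finite_second_moments_def)
  ultimately show "integrable M (\<lambda>w. B w $ i)"
    by (rule square_integrable_imp_integrable)
qed

text \<open>Total mass one gives E(c) = c, and linearity gives E(c C^T) = c E(C)^T, so the two terms
  of the covariance cancel.\<close>

lemma cov_const_left:
  assumes "square_integrable_vec M C"
  shows "cov M (\<lambda>w. c) C = 0"
  using integral_linear_euclidean(2)[OF linear_outer_right square_integrable_vec_imp_integrable[OF assms]]
  by (simp add: cov_def prob_space)

lemma cov_diff_left:
  assumes "square_integrable_vec M B" "square_integrable_vec M B'" "square_integrable_vec M C"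
  shows "cov M (\<lambda>w. B w - B' w) C = cov M B C - cov M B' C"
  using assms
  by (simp add: cov_def outer_diff_left integrable_outer square_integrable_vec_imp_integrable)

lemma cov_matrix_left:
  assumes "square_integrable_vec M B" "square_integrable_vec M C"
  shows "cov M (\<lambda>w. A *v B w) C = A ** cov M B C"
  using integral_linear_euclidean(2)[OF linear_matrix_mul_left[of A] integrable_outer[OF assms]]
    integral_linear_euclidean(2)[OF matrix_vector_mul_linear[of A]
      square_integrable_vec_imp_integrable[OF assms(1)]]
  by (simp add: cov_def outer_matrix_left linear_diff[OF linear_matrix_mul_left])

section \<open>Adjusted vectors and adjusted covariances\<close>

lemma adjusted_version_eq:
  "B w - adj_exp M D B w = (B w - adj_P M D B *v D w) - (expectation B - adj_P M D B *v expectation D)"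
  by (simp add: adj_exp_def matrix_vector_mult_diff_distrib)

lemma square_integrable_vec_adjusted:
  assumes "square_integrable_vec M B" "square_integrable_vec M D"
  shows "square_integrable_vec M (\<lambda>w. B w - adj_exp M D B w)"
  unfolding adjusted_version_eq
  by (intro square_integrable_vec_diff square_integrable_vec_matrix square_integrable_vec_const assms)

lemma cov_adjusted_left:
  assumes "square_integrable_vec M B" "square_integrable_vec M C" "square_integrable_vec M D"
  shows "cov M (\<lambda>w. B w - adj_exp M D B w) C = cov M B C - adj_P M D B ** cov M D C"
  \<comment> \<open>The residual is now a linear combination of \<open>B\<close> and
    \<open>D\<close> minus a constant, and the constant has zero covariance with
    \<open>C\<close>.\<close>
  unfolding adjusted_version_eq
  by (simp add: cov_diff_left cov_const_left cov_matrix_left square_integrable_vec_diff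
      square_integrable_vec_matrix square_integrable_vec_const assms)

lemma transpose_adj_P:
  assumes "square_integrable_vec M B" "square_integrable_vec M D"
  shows "transpose (adj_P M D B) = pinv (var M D) ** cov M D B"
  using assms by (simp add: adj_P_def matrix_transpose_mul transpose_pinv transpose_cov var_def)

text \<open>Obtained by transposing the left-hand rule, so linearity of the covariance is developed
  in its first argument only.\<close>

lemma cov_adjusted_right:
  assumes "square_integrable_vec M B" "square_integrable_vec M C" "square_integrable_vec M D"
  shows "cov M C (\<lambda>w. B w - adj_exp M D B w) = cov M C B - cov M C D ** pinv (var M D) ** cov M D B"
proof -
  have "cov M C (\<lambda>w. B w - adj_exp M D B w) = transpose (cov M B C - adj_P M D B ** cov M D C)"
    by (simp only: cov_adjusted_left[symmetric] transpose_cov square_integrable_vec_adjusted assms)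
  then show ?thesis
    using assms by (simp add: linear_diff[OF linear_transpose] transpose_cov matrix_transpose_mul
        transpose_adj_P matrix_mul_assoc)
qed

text \<open>Expanding the first argument leaves the covariance of \<open>B\<close> with the residual
  of \<open>C\<close>, minus \<open>adj_P M D B\<close> times that of \<open>D\<close> with this
  residual. The latter product vanishes: \<open>adj_P M D B\<close> ends with the factor
  \<open>?G\<close>, and \<open>?G\<close> annihilates the covariance by
  \<open>?G ** cov M D D ** ?G = ?G\<close>, even for singular \<open>var M D\<close>.\<close>

lemma adj_cov_eq:
  assumes "square_integrable_vec M B" "square_integrable_vec M C" "square_integrable_vec M D"
  shows "adj_cov M D B C = cov M B C - adj_P M D B ** cov M D C"
proof -
  let ?G = "pinv (var M D)"
  have "?G ** cov M D D ** ?G = ?G"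
    using moore_penrose_pinv[of "var M D"] by (simp add: moore_penrose_def var_def[symmetric])
  then have "?G ** cov M D D ** ?G ** cov M D C = ?G ** cov M D C"
    by simp
  then have "cov M D (\<lambda>w. C w - adj_exp M D C w) = cov M D C - cov M D D ** ?G ** cov M D C"
    "?G ** (cov M D C - cov M D D ** ?G ** cov M D C) = 0"
    using assms by (simp_all add: cov_adjusted_right linear_diff[OF linear_matrix_mul_left] matrix_mul_assoc)
  then have "adj_P M D B ** cov M D (\<lambda>w. C w - adj_exp M D C w) = 0"
    by (simp add: adj_P_def matrix_mul_assoc[symmetric] linear_0[OF linear_matrix_mul_left])
  then show ?thesis
    using assms unfolding adj_cov_def
    by (simp add: cov_adjusted_left cov_adjusted_right square_integrable_vec_adjusted adj_P_def)
qed

lemma adjusted_orthogonal_sym: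
  assumes "square_integrable_vec M B" "square_integrable_vec M C" "square_integrable_vec M D"
    and "adjusted_orthogonal M D B C"
  shows "adjusted_orthogonal M D C B"
proof -
  have "adj_cov M D C B = transpose (adj_cov M D B C)"
    unfolding adj_cov_def
    by (simp only: transpose_cov square_integrable_vec_adjusted assms)
  then show ?thesis
    using assms(4) by (simp add: adjusted_orthogonal_def linear_0[OF linear_transpose])
qed

lemma adj_P_compose:
  assumes "square_integrable_vec M B" "square_integrable_vec M C" "square_integrable_vec M D"
    and "adjusted_orthogonal M D B C"
  shows "adj_P M C B = adj_P M D B ** adj_P M C D"
proof -
  have "cov M B C = adj_P M D B ** cov M D C"
    using assms by (simp add: adjusted_orthogonal_def adj_cov_eq)
  \<comment> \<open>Only the coefficients conditioned on \<open>C\<close> are unfolded; both contain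
    \<open>pinv (var M C)\<close> as last factor, while \<open>adj_P M D B\<close> stays
    folded.\<close>
  then show ?thesis
    unfolding adj_P_def[of M C] by (simp add: matrix_mul_assoc)
qed

end

theorem theorem1:
  fixes M :: "'w measure"
    and X :: "'w \<Rightarrow> real ^ 'x" and Y :: "'w \<Rightarrow> real ^ 'y" and Z :: "'w \<Rightarrow> real ^ 'z"
  assumes "prob_space M"
    and "X \<in> borel_measurable M" and "Y \<in> borel_measurable M" and "Z \<in> borel_measurable M"
    and "finite_second_moments M X" and "finite_second_moments M Y" and "finite_second_moments M Z"
    and "adjusted_orthogonal M Y X Z"
  shows "adj_P M X Z = adj_P M Y Z ** adj_P M X Y \<and>
    adj_T M X Z = adj_P M Y Z ** adj_T M X Y ** adj_P M Z Y"
proof -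
  interpret prob_space M by fact
  have sq: "square_integrable_vec M X" "square_integrable_vec M Y" "square_integrable_vec M Z"
    using assms by (simp_all add: square_integrable_vec_def)
  have XZ: "adj_P M Z X = adj_P M Y X ** adj_P M Z Y"
    by (rule adj_P_compose[OF sq(1,3,2) assms(8)])
  have ZX: "adj_P M X Z = adj_P M Y Z ** adj_P M X Y"
    by (rule adj_P_compose[OF sq(3,1,2) adjusted_orthogonal_sym[OF sq(1,3,2) assms(8)]])
  \<comment> \<open>Multiplying \<open>ZX\<close> by \<open>XZ\<close> puts
    \<open>adj_P M X Y ** adj_P M Y X\<close> in the middle, which is
    \<open>adj_T M X Y\<close>.\<close>
  show ?thesis
    by (simp add: adj_T_def XZ ZX matrix_mul_assoc)
qed

end
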